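(* Let $G$ be a finite multigraph (loops allowed) on vertex set $V$. For $a,b\in\mathbb N^V$ let $N(a,b)$ be the number of orientations of $G$ such that $d^+(x)\ge a_x$ and $d^-(x)\ge b_x$ for all $x\in V$. If $a,b,r,s\in\mathbb N^V$ satisfy $$a\ge r,\qquad a\ge s,\qquad a+b\ge r+s$$ (inequalities with respect to the product order on $\mathbb N^V$), then $$N(a,b)\le N(r,s).$$
   Context: $\mathbb N=\{0,1,2,\dots\}$. In an orientation, each edge is given one of its two directions; $d^+(x)$ and $d^-(x)$ denote the out-degree and in-degree of $x$. A loop at $x$ is regarded as having two distinct orientations, each of which contributes $1$ to $d^+(x)$ and $1$ to $d^-(x)$. *)

theory Defs
  imports "HOL-Library.FuncSet" "HOL-Library.Uprod" "Graph_Theory.Digraph"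
begin

(* Edges are elements of an arbitrary type, so parallel edges are allowed;
   a loop at x is an edge e with ends G e = Upair x x. *)
record ('v, 'e) multigraph =
  vertices :: "'v set"
  edges :: "'e set"
  ends :: "'e \<Rightarrow> 'v uprod"

definition finite_multigraph :: "('v, 'e) multigraph \<Rightarrow> bool" where
  "finite_multigraph G \<longleftrightarrow>
     finite (vertices G) \<and> finite (edges G) \<and>
     (\<forall>e \<in> edges G. set_uprod (ends G e) \<subseteq> vertices G)"

(* A direction (x, y, t) goes from x to y. The tag t only serves to tell apart the
   two directions of a loop; a non-loop edge has just the directions
   (x, y, False) and (y, x, False). *)
definition directions :: "'v uprod \<Rightarrow> ('v \<times> 'v \<times> bool) set" where
  "directions p = {(x, y, t). Upair x y = p \<and> (t \<longrightarrow> x = y)}"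

lemma directions_nonloop:
  "x \<noteq> y \<Longrightarrow> directions (Upair x y) = {(x, y, False), (y, x, False)}"
  by (auto simp: directions_def)

lemma directions_loop:
  "directions (Upair x x) = {(x, x, False), (x, x, True)}"
  by (auto simp: directions_def)

lemma card_directions: "card (directions p) = 2"
proof (cases p)
  case (Upair x y)
  then show ?thesis
    by (cases "x = y") (auto simp: directions_nonloop directions_loop)
qed

definition orientations :: "('v, 'e) multigraph \<Rightarrow> ('e \<Rightarrow> 'v \<times> 'v \<times> bool) set" where
  "orientations G = (\<Pi>\<^sub>E e \<in> edges G. directions (ends G e))"

definition oriented ::
  "('v, 'e) multigraph \<Rightarrow> ('e \<Rightarrow> 'v \<times> 'v \<times> bool) \<Rightarrow> ('v, 'e) pre_digraph" where
  "oriented G \<omega> =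
     \<lparr>verts = vertices G, arcs = edges G,
      tail = (\<lambda>e. fst (\<omega> e)), head = (\<lambda>e. fst (snd (\<omega> e)))\<rparr>"

definition num_orientations ::
  "('v, 'e) multigraph \<Rightarrow> ('v \<Rightarrow> nat) \<Rightarrow> ('v \<Rightarrow> nat) \<Rightarrow> nat" where
  "num_orientations G a b =
     card {\<omega> \<in> orientations G. \<forall>x \<in> vertices G.
       out_degree (oriented G \<omega>) x \<ge> a x \<and> in_degree (oriented G \<omega>) x \<ge> b x}"

end

theory Submission
  imports Defs
begin

text \<open>
  Reversing all edges gives N(a, b) = N(b, a), so N(a, b) squared counts the pairs of an
  (a, b)-orientation and a (b, a)-orientation. Group these pairs by the set D of edges on which the
  two orientations differ and by their common restriction to the other edges. If a vertex has
  out-degree p and in-degree q in that restriction, then the first orientation, restricted to D, is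
  subject to the demands a - min p q and b - min p q, so each group is counted by the same
  problem on D. The groups with D a proper subset of the edge set are handled by induction, and the
  remaining one contributes N(a, b) itself. Hence N (N - 1) \<open>\<le>\<close> N' (N' - 1) for N = N(a, b) and
  N' = N(r, s), which gives N \<open>\<le>\<close> N' as soon as N > 0 implies N' > 0. This last implication follows by
  deleting an edge whose tail x satisfies a x > min (r x) (s x).
\<close>

section \<open>Orientations encoded as edge sets, and their degrees\<close>

text \<open>
  With respect to a reference orientation with tails t and heads h, a set S encodes the orientation
  in which exactly the edges outside S are reversed; thus the complement of S encodes the opposite
  orientation, and in-degrees are out-degrees of the complement. Demands are integers because the
  induction may make them negative.
\<close>

definition outdeg :: "('e \<Rightarrow> 'v) \<Rightarrow> ('e \<Rightarrow> 'v) \<Rightarrow> 'e set \<Rightarrow> 'e set \<Rightarrow> 'v \<Rightarrow> int" where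
  "outdeg t h E S x = (\<Sum>e\<in>E. of_bool ((if e \<in> S then t e else h e) = x))"

definition feasible ::
  "('e \<Rightarrow> 'v) \<Rightarrow> ('e \<Rightarrow> 'v) \<Rightarrow> 'e set \<Rightarrow> ('v \<Rightarrow> int) \<Rightarrow> ('v \<Rightarrow> int) \<Rightarrow> 'e set set" where
  "feasible t h E a b =
     {S. S \<subseteq> E \<and> (\<forall>x. a x \<le> outdeg t h E S x \<and> b x \<le> outdeg t h E (- S) x)}"

lemma outdeg_cong:
  assumes "S \<inter> E = T \<inter> E"
  shows "outdeg t h E S = outdeg t h E T"
proof
  fix x
  from assms have "\<And>e. e \<in> E \<Longrightarrow> e \<in> S \<longleftrightarrow> e \<in> T" by blast
  then show "outdeg t h E S x = outdeg t h E T x"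
    unfolding outdeg_def by (intro sum.cong) auto
qed

lemma outdeg_Un:
  assumes "finite C" "finite D" "C \<inter> D = {}"
  shows "outdeg t h (C \<union> D) S x = outdeg t h C S x + outdeg t h D S x"
  unfolding outdeg_def using assms by (rule sum.union_disjoint)

lemma outdeg_insert:
  assumes "finite E" "e \<notin> E"
  shows "outdeg t h (insert e E) S x =
    of_bool ((if e \<in> S then t e else h e) = x) + outdeg t h E S x"
  unfolding outdeg_def using assms by (rule sum.insert)

lemma finite_feasible: "finite E \<Longrightarrow> finite (feasible t h E a b)"
  by (rule finite_subset[of _ "Pow E"]) (auto simp: feasible_def)

section \<open>Transfer of feasibility\<close>

text \<open>Deleting an edge from x to y of the orientation \<open>S\<close> lowers \<open>a\<close>
  by one at x and \<open>b\<close> by one at y. The hypotheses survive if one of \<open>r\<close>,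
  \<open>s\<close> is lowered at x and the other at y. The one lowered only at y might exceed the
  new \<open>a\<close> at x, so it must be the one that is smaller than \<open>a\<close> there. When
  no edge can be deleted in this way, \<open>S\<close> itself meets the new demands.\<close>

lemma feasible_nonempty_mono:
  assumes "finite E"
    and "\<And>x. r x \<le> a x" "\<And>x. s x \<le> a x" "\<And>x. r x + s x \<le> a x + b x"
    and "\<And>x. a x \<le> outdeg t h E S x" "\<And>x. b x \<le> outdeg t h E (- S) x"
  shows "\<exists>T. \<forall>x. r x \<le> outdeg t h E T x \<and> s x \<le> outdeg t h E (- T) x"
  using assms
proof (induction E arbitrary: a b r s rule: finite_psubset_induct)
  case (psubset E)
  let ?tail = "\<lambda>e. if e \<in> S then t e else h e"
  let ?head = "\<lambda>e. if e \<in> S then h e else t e"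
  show ?case
  proof (cases "\<exists>e\<in>E. min (r (?tail e)) (s (?tail e)) < a (?tail e)")
    case True
    then obtain e where e: "e \<in> E" and gap: "min (r (?tail e)) (s (?tail e)) < a (?tail e)"
      by blast
    define E' where "E' = E - {e}"
    define x where "x = ?tail e"
    define y where "y = ?head e"
    have E': "E = insert e E'" "e \<notin> E'" "finite E'" "E' \<subset> E"
      using e psubset.hyps by (auto simp: E'_def)
    let ?one = "\<lambda>u v. of_bool (u = v) :: int"
    have out: "outdeg t h E S z = ?one x z + outdeg t h E' S z"
      and inn: "outdeg t h E (- S) z = ?one y z + outdeg t h E' (- S) z" for z
      using E' by (auto simp: outdeg_insert x_def y_def)
    have del: "\<exists>T. \<forall>z. r' z \<le> outdeg t h E' T z \<and> s' z \<le> outdeg t h E' (- T) z"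
      if "\<And>z. r' z \<le> a z - ?one x z" "\<And>z. s' z \<le> a z - ?one x z"
        "\<And>z. r' z + s' z \<le> (a z - ?one x z) + (b z - ?one y z)" for r' s'
    proof (rule psubset.IH[OF \<open>E' \<subset> E\<close>])
      show "a z - ?one x z \<le> outdeg t h E' S z" for z
        using psubset.prems(4)[of z] out[of z] by linarith
      show "b z - ?one y z \<le> outdeg t h E' (- S) z" for z
        using psubset.prems(5)[of z] inn[of z] by linarith
    qed (use that in auto)
    \<comment> \<open>Since \<open>e\<close> is not in \<open>E'\<close>, its membership in
      \<open>T\<close> is immaterial there, and \<open>B\<close> alone decides how \<open>e\<close>
      is directed.\<close>
    have extend: "outdeg t h E (if B then insert e T else T - {e}) z =
          of_bool ((if B then t e else h e) = z) + outdeg t h E' T z"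
      "outdeg t h E (- (if B then insert e T else T - {e})) z =
          of_bool ((if B then h e else t e) = z) + outdeg t h E' (- T) z" for B T z
    proof -
      let ?U = "if B then insert e T else T - {e}"
      have "outdeg t h E' ?U = outdeg t h E' T" "outdeg t h E' (- ?U) = outdeg t h E' (- T)"
        using \<open>e \<notin> E'\<close> by (auto intro!: outdeg_cong)
      with E' show
        "outdeg t h E ?U z = of_bool ((if B then t e else h e) = z) + outdeg t h E' T z"
        "outdeg t h E (- ?U) z = of_bool ((if B then h e else t e) = z) + outdeg t h E' (- T) z"
        by (simp_all add: outdeg_insert)
    qed
    note prems = psubset.prems(1-3)
    consider "s x < a x" | "r x < a x"
      using gap unfolding x_def min_less_iff_disj by blast
    then show ?thesis
    proof cases
      case 1
      have "\<exists>T. \<forall>z. r z - ?one x z \<le> outdeg t h E' T z \<and> s z - ?one y z \<le> outdeg t h E' (- T) z"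
      proof (rule del)
        fix z
        show "r z - ?one x z \<le> a z - ?one x z" using prems(1)[of z] by simp
        show "s z - ?one y z \<le> a z - ?one x z" using prems(2)[of z] 1 by auto
        show "r z - ?one x z + (s z - ?one y z) \<le> a z - ?one x z + (b z - ?one y z)"
          using prems(3)[of z] by simp
      qed
      then obtain T where T: "\<And>z. r z - ?one x z \<le> outdeg t h E' T z"
        "\<And>z. s z - ?one y z \<le> outdeg t h E' (- T) z" by blast
      \<comment> \<open>Here \<open>e\<close> keeps its direction from \<open>S\<close>, so it
        serves \<open>r\<close> at x and \<open>s\<close> at y.\<close>
      define U where "U = (if e \<in> S then insert e T else T - {e})"
      have "outdeg t h E U z = ?one x z + outdeg t h E' T z"
        "outdeg t h E (- U) z = ?one y z + outdeg t h E' (- T) z" for z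
        unfolding U_def extend x_def y_def by simp_all
      with T show ?thesis by (intro exI[of _ U]) (smt (verit))
    next
      case 2
      have "\<exists>T. \<forall>z. r z - ?one y z \<le> outdeg t h E' T z \<and> s z - ?one x z \<le> outdeg t h E' (- T) z"
      proof (rule del)
        fix z
        show "r z - ?one y z \<le> a z - ?one x z" using prems(1)[of z] 2 by auto
        show "s z - ?one x z \<le> a z - ?one x z" using prems(2)[of z] by simp
        show "r z - ?one y z + (s z - ?one x z) \<le> a z - ?one x z + (b z - ?one y z)"
          using prems(3)[of z] by simp
      qed
      then obtain T where T: "\<And>z. r z - ?one y z \<le> outdeg t h E' T z"
        "\<And>z. s z - ?one x z \<le> outdeg t h E' (- T) z" by blast
      \<comment> \<open>Here \<open>e\<close> is reversed, so it serves \<open>r\<close> at y and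
        \<open>s\<close> at x.\<close>
      define U where "U = (if e \<notin> S then insert e T else T - {e})"
      have "outdeg t h E U z = ?one y z + outdeg t h E' T z"
        "outdeg t h E (- U) z = ?one x z + outdeg t h E' (- T) z" for z
        unfolding U_def extend x_def y_def by simp_all
      with T show ?thesis by (intro exI[of _ U]) (smt (verit))
    qed
  next
    case False
    \<comment> \<open>At the tail of an edge, \<open>r\<close>, \<open>s\<close> and
      \<open>a\<close> coincide, and the sum condition then bounds them by \<open>b\<close>. A
      vertex that is no tail has out-degree 0, so \<open>a\<close>, and with it \<open>r\<close> and
      \<open>s\<close>, is at most 0 there.\<close>
    have "r x \<le> outdeg t h E S x \<and> s x \<le> outdeg t h E (- S) x" for x
    proof (cases "\<exists>e\<in>E. ?tail e = x")
      case True
      with False have "a x \<le> min (r x) (s x)" by force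
      then have "s x \<le> b x" using psubset.prems(3)[of x] psubset.prems(1,2)[of x] by linarith
      then show ?thesis using psubset.prems(1,4,5)[of x] by linarith
    next
      case False
      then have "outdeg t h E S x = 0" by (auto simp: outdeg_def intro!: sum.neutral)
      moreover have "0 \<le> outdeg t h E (- S) x" by (simp add: outdeg_def sum_nonneg)
      ultimately show ?thesis using psubset.prems(1,2,4)[of x] by linarith
    qed
    then show ?thesis by blast
  qed
qed

section \<open>Reversal, and counting pairs of opposite demands\<close>

lemma card_feasible_swap: "card (feasible t h E b a) = card (feasible t h E a b)"
proof (rule bij_betw_same_card)
  have eq: "outdeg t h E (E - S) = outdeg t h E (- S)"
    "outdeg t h E (- E \<union> S) = outdeg t h E S" for S
    by (auto intro!: outdeg_cong)
  show "bij_betw (\<lambda>S. E - S) (feasible t h E b a) (feasible t h E a b)"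
    by (rule bij_betw_byWitness[of _ "\<lambda>S. E - S"]) (auto simp: feasible_def eq)
qed

lemma card_feasible_folding:
  fixes a b :: "'v \<Rightarrow> int"
  assumes "finite E"
  shows "card (feasible t h E a b) * card (feasible t h E b a) =
    (\<Sum>D\<in>Pow E. \<Sum>K\<in>Pow (E - D).
      let m = (\<lambda>x. min (outdeg t h (E - D) K x) (outdeg t h (E - D) (- K) x))
      in card (feasible t h D (\<lambda>x. a x - m x) (\<lambda>x. b x - m x)))"
proof -
  define m where "m D K x = min (outdeg t h (E - D) K x) (outdeg t h (E - D) (- K) x)" for D K x
  define F where "F D K = feasible t h D (\<lambda>x. a x - m D K x) (\<lambda>x. b x - m D K x)" for D K
  let ?\<Sigma> = "SIGMA D:Pow E. SIGMA K:Pow (E - D). F D K"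
  \<comment> \<open>\<open>D\<close> is the set of edges where the two orientations differ,
    \<open>K\<close> encodes their common restriction to the other edges, and \<eta> the first
    orientation on \<open>D\<close>; the second one on \<open>D\<close> is then
    \<open>D - \<eta>\<close>.\<close>
  let ?join = "\<lambda>(D, K, \<eta>). (K \<union> \<eta>, K \<union> (D - \<eta>))"
  let ?split = "\<lambda>(S, T). ((S - T) \<union> (T - S), S \<inter> T, S - T)"
  \<comment> \<open>Let p and q be the out- and in-degree of x in \<open>K\<close> on
    \<open>E - D\<close>. The out-degree of \<eta> at x occurs in the out-degree of the first
    orientation and in the in-degree of the second, so the two demands \<open>a x\<close> require it
    to be at least both \<open>a x - p\<close> and \<open>a x - q\<close>, that is
    \<open>a x - min p q\<close>. The in-degree of \<eta> and \<open>b x\<close> are related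
    likewise.\<close>
  have iff: "(K \<union> \<eta> \<in> feasible t h E a b \<and> K \<union> (D - \<eta>) \<in> feasible t h E b a) \<longleftrightarrow> \<eta> \<in> F D K"
    if "D \<subseteq> E" "K \<subseteq> E - D" "\<eta> \<subseteq> D" for D K \<eta>
  proof -
    have E: "E = (E - D) \<union> D" using that by blast
    have split: "outdeg t h E S x = outdeg t h (E - D) S x + outdeg t h D S x" for S x
      using outdeg_Un[of "E - D" D t h S x] assms \<open>D \<subseteq> E\<close> E finite_subset by auto
    have "outdeg t h (E - D) (K \<union> \<eta>) = outdeg t h (E - D) K"
      "outdeg t h (E - D) (- (K \<union> \<eta>)) = outdeg t h (E - D) (- K)"
      "outdeg t h (E - D) (K \<union> (D - \<eta>)) = outdeg t h (E - D) K"
      "outdeg t h (E - D) (- (K \<union> (D - \<eta>))) = outdeg t h (E - D) (- K)"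
      "outdeg t h D (K \<union> \<eta>) = outdeg t h D \<eta>"
      "outdeg t h D (- (K \<union> \<eta>)) = outdeg t h D (- \<eta>)"
      "outdeg t h D (K \<union> (D - \<eta>)) = outdeg t h D (- \<eta>)"
      "outdeg t h D (- (K \<union> (D - \<eta>))) = outdeg t h D \<eta>"
      using that by (auto intro!: outdeg_cong)
    note degs = this
    have sub: "K \<union> \<eta> \<subseteq> E" "K \<union> (D - \<eta>) \<subseteq> E" using that by auto
    show ?thesis
      unfolding F_def feasible_def mem_Collect_eq split degs m_def
      using sub \<open>\<eta> \<subseteq> D\<close> by (auto simp: min_def diff_le_eq) (smt (verit))+
  qed
  have "bij_betw ?join ?\<Sigma> (feasible t h E a b \<times> feasible t h E b a)"
  proof (rule bij_betw_byWitness[of _ ?split])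
    have sub: "D \<subseteq> E \<and> K \<subseteq> E - D \<and> \<eta> \<subseteq> D" if "(D, K, \<eta>) \<in> ?\<Sigma>" for D K \<eta>
      using that by (auto simp: F_def feasible_def)
    show "\<forall>p\<in>?\<Sigma>. ?split (?join p) = p"
    proof
      fix p assume p: "p \<in> ?\<Sigma>"
      obtain D K \<eta> where [simp]: "p = (D, K, \<eta>)" by (cases p)
      from sub[of D K \<eta>] p show "?split (?join p) = p" by auto
    qed
    show "\<forall>q\<in>feasible t h E a b \<times> feasible t h E b a. ?join (?split q) = q" by auto
    show "?join ` ?\<Sigma> \<subseteq> feasible t h E a b \<times> feasible t h E b a"
    proof (rule image_subsetI)
      fix p assume p: "p \<in> ?\<Sigma>"
      obtain D K \<eta> where [simp]: "p = (D, K, \<eta>)" by (cases p)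
      from sub[of D K \<eta>] p iff[of D K \<eta>]
      show "?join p \<in> feasible t h E a b \<times> feasible t h E b a" by auto
    qed
    show "?split ` (feasible t h E a b \<times> feasible t h E b a) \<subseteq> ?\<Sigma>"
    proof (rule image_subsetI)
      fix q assume q: "q \<in> feasible t h E a b \<times> feasible t h E b a"
      obtain S T where q_eq: "q = (S, T)" by (cases q)
      define D where "D = (S - T) \<union> (T - S)"
      have ST: "S \<in> feasible t h E a b" "T \<in> feasible t h E b a" using q q_eq by auto
      then have "S \<subseteq> E" "T \<subseteq> E" by (auto simp: feasible_def)
      then have sub: "D \<subseteq> E" "S \<inter> T \<subseteq> E - D" "S - T \<subseteq> D" by (auto simp: D_def)
      have "S \<inter> T \<union> (S - T) = S" "S \<inter> T \<union> (D - (S - T)) = T" by (auto simp: D_def)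
      then have "S - T \<in> F D (S \<inter> T)" using ST iff[OF sub] by simp
      with sub show "?split q \<in> ?\<Sigma>" by (simp add: q_eq flip: D_def)
    qed
  qed
  then have "card (feasible t h E a b) * card (feasible t h E b a) = card ?\<Sigma>"
    by (simp only: bij_betw_same_card card_cartesian_product)
  also have "\<dots> = (\<Sum>D\<in>Pow E. \<Sum>K\<in>Pow (E - D). card (F D K))"
  proof -
    have finF: "finite (F D K)" if "D \<in> Pow E" for D K
      unfolding F_def using that assms by (intro finite_feasible finite_subset[of D E]) simp_all
    have "card ?\<Sigma> = (\<Sum>D\<in>Pow E. card (SIGMA K:Pow (E - D). F D K))"
      using assms finF by (intro card_SigmaI ballI finite_SigmaI) simp_all
    also have "\<dots> = (\<Sum>D\<in>Pow E. \<Sum>K\<in>Pow (E - D). card (F D K))"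
      using assms finF by (intro sum.cong refl card_SigmaI ballI) simp_all
    finally show ?thesis .
  qed
  finally show ?thesis by (simp add: F_def m_def[abs_def] Let_def)
qed

section \<open>The inequality for edge sets\<close>

lemma card_feasible_mono:
  fixes a b r s :: "'v \<Rightarrow> int"
  assumes "finite E"
    and "\<And>x. r x \<le> a x" "\<And>x. s x \<le> a x" "\<And>x. r x + s x \<le> a x + b x"
  shows "card (feasible t h E a b) \<le> card (feasible t h E r s)"
  using assms
proof (induction E arbitrary: a b r s rule: finite_psubset_induct)
  case (psubset E)
  let ?m = "\<lambda>D K x. min (outdeg t h (E - D) K x) (outdeg t h (E - D) (- K) x)"
  let ?rest = "\<lambda>a b. \<Sum>D\<in>Pow E - {E}. \<Sum>K\<in>Pow (E - D).
    card (feasible t h D (\<lambda>x. a x - ?m D K x) (\<lambda>x. b x - ?m D K x))"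
  let ?N = "card (feasible t h E a b)"
  let ?N' = "card (feasible t h E r s)"
  have sq: "card (feasible t h E a b) ^ 2 = card (feasible t h E a b) + ?rest a b" for a b
  proof -
    have "card (feasible t h E a b) ^ 2 =
        (\<Sum>D\<in>Pow E. \<Sum>K\<in>Pow (E - D).
          card (feasible t h D (\<lambda>x. a x - ?m D K x) (\<lambda>x. b x - ?m D K x)))"
      using card_feasible_folding[OF psubset.hyps(1), of t h a b] card_feasible_swap[of t h E b a]
      by (simp add: power2_eq_square Let_def)
    \<comment> \<open>For \<open>D = E\<close> the only \<open>K\<close> is the empty set and no
      edges are left outside \<open>D\<close>, so the correction \<open>?m\<close> vanishes and the
      term is the original count.\<close>
    also have "\<dots> = card (feasible t h E a b) + ?rest a b"
      using psubset.hyps(1) by (subst sum.remove[of _ E]) (auto simp: outdeg_def)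
    finally show ?thesis .
  qed
  have "?rest a b \<le> ?rest r s"
  proof (intro sum_mono)
    fix D K assume "D \<in> Pow E - {E}" "K \<in> Pow (E - D)"
    then have "D \<subset> E" by auto
    \<comment> \<open>All four demands are lowered by the same function, which preserves the three
      inequalities between them.\<close>
    then show "card (feasible t h D (\<lambda>x. a x - ?m D K x) (\<lambda>x. b x - ?m D K x))
        \<le> card (feasible t h D (\<lambda>x. r x - ?m D K x) (\<lambda>x. s x - ?m D K x))"
      by (rule psubset.IH) (use psubset.prems in \<open>simp_all add: algebra_simps\<close>)
  qed
  with sq[of a b] sq[of r s] have le: "?N ^ 2 + ?N' \<le> ?N' ^ 2 + ?N" by linarith
  have pos: "?N' > 0" if "?N > 0"
  proof -
    from that have "feasible t h E a b \<noteq> {}" by force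
    then obtain S where "\<And>x. a x \<le> outdeg t h E S x" "\<And>x. b x \<le> outdeg t h E (- S) x"
      by (auto simp: feasible_def)
    then obtain T where T: "\<And>x. r x \<le> outdeg t h E T x" "\<And>x. s x \<le> outdeg t h E (- T) x"
      using feasible_nonempty_mono[OF psubset.hyps(1), of r a s b t h S] psubset.prems by blast
    \<comment> \<open>Members of \<open>feasible\<close> are subsets of \<open>E\<close>; cutting
      \<open>T\<close> down to \<open>E\<close> changes no degree.\<close>
    have "outdeg t h E (T \<inter> E) = outdeg t h E T" "outdeg t h E (- (T \<inter> E)) = outdeg t h E (- T)"
      by (auto intro!: outdeg_cong)
    with T have "T \<inter> E \<in> feasible t h E r s" by (simp add: feasible_def)
    then show ?thesis
      using finite_feasible[OF psubset.hyps(1)] by (auto simp: card_gt_0_iff)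
  qed
  show ?case
  proof (rule ccontr)
    assume "\<not> ?N \<le> ?N'"
    \<comment> \<open>The map n(n - 1) is strictly increasing from n = 1 on, but takes the value 0
      at both 0 and 1. Positivity of \<open>?N'\<close> rules out the case \<open>?N' = 0\<close>,
      \<open>?N = 1\<close>.\<close>
    then have *: "?N' < ?N" "0 < ?N'" using pos by auto
    then have "?N' * (?N - 1) < ?N * (?N - 1)" by simp
    moreover have "?N' * (?N' - 1) \<le> ?N' * (?N - 1)" using * by simp
    ultimately show False
      using le * by (simp add: power2_eq_square algebra_simps diff_mult_distrib2)
  qed
qed

section \<open>Back to multigraphs\<close>

text \<open>Sending an edge set to the orientation that reverses exactly the other edges is a
  bijection onto all orientations, and it respects degrees. The default demand 0 outside the vertex
  set is vacuous because degrees are nonnegative.\<close>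

lemma num_orientations_eq_card_feasible:
  fixes G :: "('v, 'e) multigraph"
  assumes ends: "\<And>e. ends G e = Upair (t e) (h e)" and "finite (edges G)"
  shows "num_orientations G a b =
    card (feasible t h (edges G)
      (\<lambda>x. if x \<in> vertices G then int (a x) else 0) (\<lambda>x. if x \<in> vertices G then int (b x) else 0))"
proof -
  let ?E = "edges G"
  \<comment> \<open>The tag \<open>t e = h e\<close> makes the reversed direction of a loop differ
    from the reference one, so that \<phi> stays injective; for other edges it is
    \<open>False\<close>, as \<open>directions\<close> demands.\<close>
  define \<phi> where "\<phi> S = (\<lambda>e\<in>?E. if e \<in> S then (t e, h e, False) else (h e, t e, t e = h e))" for S
  have dirs: "directions (ends G e) = {(t e, h e, False), (h e, t e, t e = h e)}" for e
    unfolding ends by (cases "t e = h e") (auto simp: directions_nonloop directions_loop)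
  have "inj_on \<phi> (Pow ?E)"
  proof (rule inj_onI)
    fix S T assume ST: "S \<in> Pow ?E" "T \<in> Pow ?E" and eq: "\<phi> S = \<phi> T"
    have "e \<in> S \<longleftrightarrow> e \<in> T" if "e \<in> ?E" for e
      using fun_cong[OF eq, of e] that by (auto simp: \<phi>_def split: if_splits)
    with ST show "S = T" by blast
  qed
  have "orientations G = \<phi> ` Pow ?E"
  proof
    show "\<phi> ` Pow ?E \<subseteq> orientations G"
      by (auto simp: \<phi>_def orientations_def dirs)
    show "orientations G \<subseteq> \<phi> ` Pow ?E"
    proof
      fix \<omega> assume \<omega>: "\<omega> \<in> orientations G"
      \<comment> \<open>The encoding set is recovered as the edges that have their reference
        direction.\<close>
      have "\<omega> = \<phi> {e \<in> ?E. \<omega> e = (t e, h e, False)}"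
      proof
        fix e
        show "\<omega> e = \<phi> {e \<in> ?E. \<omega> e = (t e, h e, False)} e"
          using \<omega> by (cases "e \<in> ?E") (auto simp: \<phi>_def orientations_def dirs PiE_iff extensional_def)
      qed
      then show "\<omega> \<in> \<phi> ` Pow ?E" by blast
    qed
  qed
  have out: "int (out_degree (oriented G (\<phi> S)) x) = outdeg t h ?E S x" for S x
  proof -
    have "out_arcs (oriented G (\<phi> S)) x = {e \<in> ?E. (if e \<in> S then t e else h e) = x}"
      by (auto simp: out_arcs_def oriented_def \<phi>_def)
    with \<open>finite ?E\<close> show ?thesis
      by (simp add: out_degree_def outdeg_def of_bool_def sum.If_cases Int_def)
  qed
  have inn: "int (in_degree (oriented G (\<phi> S)) x) = outdeg t h ?E (- S) x" for S x
  proof -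
    have "in_arcs (oriented G (\<phi> S)) x = {e \<in> ?E. (if e \<in> - S then t e else h e) = x}"
      by (auto simp: in_arcs_def oriented_def \<phi>_def)
    with \<open>finite ?E\<close> show ?thesis
      by (simp add: in_degree_def outdeg_def of_bool_def sum.If_cases Int_def)
  qed
  let ?F = "feasible t h ?E
    (\<lambda>x. if x \<in> vertices G then int (a x) else 0) (\<lambda>x. if x \<in> vertices G then int (b x) else 0)"
  let ?ok = "\<lambda>\<omega>. \<forall>x \<in> vertices G.
    out_degree (oriented G \<omega>) x \<ge> a x \<and> in_degree (oriented G \<omega>) x \<ge> b x"
  have "0 \<le> outdeg t h ?E S x" for S x by (simp add: outdeg_def sum_nonneg)
  then have ok_iff: "?ok (\<phi> S) \<longleftrightarrow> S \<in> ?F" if "S \<in> Pow ?E" for S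
    unfolding of_nat_le_iff[symmetric, where 'a = int] out inn
    using that by (auto simp: feasible_def)
  have sub: "?F \<subseteq> Pow ?E" by (auto simp: feasible_def)
  have "{\<omega> \<in> \<phi> ` A. P \<omega>} = \<phi> ` {S \<in> A. P (\<phi> S)}" for A P by blast
  then have "{\<omega> \<in> orientations G. ?ok \<omega>} = \<phi> ` {S \<in> Pow ?E. ?ok (\<phi> S)}"
    unfolding \<open>orientations G = _\<close> .
  also have "{S \<in> Pow ?E. ?ok (\<phi> S)} = {S \<in> Pow ?E. S \<in> ?F}"
    by (rule Collect_cong) (simp only: ok_iff cong: conj_cong)
  also have "\<dots> = ?F"
    using sub by (simp only: Collect_mem_eq Collect_conj_eq Int_absorb1)
  finally show ?thesis
    using inj_on_subset[OF \<open>inj_on \<phi> _\<close> sub] by (simp add: num_orientations_def card_image)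
qed

theorem lemma8:
  fixes G :: "('v, 'e) multigraph"
    and a b r s :: "'v \<Rightarrow> nat"
  assumes "finite_multigraph G"
    and "\<And>x. x \<in> vertices G \<Longrightarrow> a x \<ge> r x"
    and "\<And>x. x \<in> vertices G \<Longrightarrow> a x \<ge> s x"
    and "\<And>x. x \<in> vertices G \<Longrightarrow> a x + b x \<ge> r x + s x"
  shows "num_orientations G a b \<le> num_orientations G r s"
proof -
  \<comment> \<open>Any ordering of the two ends of each edge can serve as the reference
    orientation.\<close>
  have "\<forall>e. \<exists>x y. ends G e = Upair x y" by (metis uprod_exhaust)
  then obtain t h where ends: "\<And>e. ends G e = Upair (t e) (h e)" by metis
  have fin: "finite (edges G)" using assms(1) by (simp add: finite_multigraph_def)
  show ?thesis
    unfolding num_orientations_eq_card_feasible[OF ends fin]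
  proof (rule card_feasible_mono[OF fin])
    show "(if x \<in> vertices G then int (r x) else 0) + (if x \<in> vertices G then int (s x) else 0)
        \<le> (if x \<in> vertices G then int (a x) else 0) + (if x \<in> vertices G then int (b x) else 0)" for x
      using assms(4)[of x] by auto
  qed (use assms(2,3) in auto)
qed

end
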